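(* Let $0\le\eta<1$ be real and let $$\tau=(1-\eta)\sin\left(\frac{\pi}{4}-\arctan\eta\right)>0.$$ Let $n$ be a positive integer and let $Z=(z_{ij})$ be a $2n\times 2n$ symmetric complex matrix such that $$\left|1-\Re z_{ij}\right|\le\eta\quad\text{and}\quad\left|\Im z_{ij}\right|\le\tau\quad\text{for all }1\le i,j\le 2n.$$ Then $\operatorname{haf}Z\ne 0$.
   Context: The hafnian of a $2n\times 2n$ symmetric matrix $Z=(z_{ij})$ is $\operatorname{haf}Z=\sum z_{i_1j_1}\cdots z_{i_nj_n}$, where the sum is over all $(2n)!/(2^n n!)$ unordered partitions of $\{1,\dots,2n\}$ into $n$ pairwise disjoint unordered pairs $\{i_1,j_1\},\dots,\{i_n,j_n\}$. $\Re z$ and $\Im z$ denote the real and imaginary parts of $z$; $\arctan$ takes values in $(-\pi/2,\pi/2)$. *)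

theory Defs
  imports
    "HOL-Analysis.Analysis"
    "HOL-Library.Disjoint_Sets"
    "Jordan_Normal_Form.Matrix"
begin

definition pairings :: "'a set \<Rightarrow> 'a set set set" where
  "pairings A = {M. partition_on A M \<and> (\<forall>P\<in>M. card P = 2)}"

text \<open>
  Matrix indices start at 0, so the rows and columns of an \<open>m \<times> m\<close> matrix are
  indexed by \<open>{..<m}\<close>. For an unordered pair \<open>P = {i, j}\<close> the factor \<open>z_ij\<close> is read off
  above the diagonal; for a symmetric matrix this is no restriction
  (see \<open>hafnian_factor\<close>).
\<close>

definition hafnian :: "'a::comm_ring_1 mat \<Rightarrow> 'a" where
  "hafnian Z = (\<Sum>M\<in>pairings {..<dim_row Z}. \<Prod>P\<in>M. Z $$ (Min P, Max P))"

lemma finite_pairings: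
  assumes "finite A"
  shows "finite (pairings A)"
proof (rule finite_subset)
  show "pairings A \<subseteq> Pow (Pow A)"
    by (auto simp: pairings_def partition_on_def)
  show "finite (Pow (Pow A))"
    using assms by simp
qed

lemma hafnian_factor:
  assumes "Z \<in> carrier_mat m m" "transpose_mat Z = Z" "i < m" "j < m"
  shows "Z $$ (Min {i, j}, Max {i, j}) = Z $$ (i, j)"
proof -
  have "Z $$ (j, i) = Z $$ (i, j)"
    using assms index_transpose_mat(1)[of i Z j] by auto
  then show ?thesis
    by (cases "i \<le> j") (auto simp: min_def max_def)
qed

end

theory Submission
  imports Defs
begin

text \<open>
  Write \<open>haf A\<close> for the sum over the perfect pairings of a vertex set \<open>A\<close>
  (\<open>pairing_sum\<close> below). Nonvanishing is proved by induction on the size of \<open>A\<close> together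
  with a geometric companion that makes the induction work: if two vertex sets
  \<open>C \<union> {j}\<close> and \<open>C \<union> {k}\<close> of the same size differ in one vertex only, then the complex
  numbers \<open>haf (C \<union> {j})\<close> and \<open>haf (C \<union> {k})\<close>, seen as vectors in the plane, enclose an
  angle of at most \<open>\<pi>/2\<close>.

  Expanding along the distinguished vertex (\<open>pairing_sum_expand\<close>),
  \<open>haf (C \<union> {j}) = (\<Sum>l\<in>C. z\<^sub>j\<^sub>l u\<^sub>l)\<close> and \<open>haf (C \<union> {k}) = (\<Sum>l\<in>C. z\<^sub>k\<^sub>l u\<^sub>l)\<close> with the same vectors
  \<open>u\<^sub>l = haf (C - {l})\<close>. The sets \<open>C - {l}\<close> and \<open>C - {l'}\<close> again differ in a single vertex,
  so the induction hypothesis says that the \<open>u\<^sub>l\<close> are nonzero and pairwise non-obtuse.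
  What remains is a statement about plane vectors (\<open>perturbed_sums\<close>): two linear
  combinations of nonzero, pairwise non-obtuse vectors, whose coefficients have real parts in
  \<open>[1 - \<eta>, 1 + \<eta>]\<close> and imaginary parts in \<open>[-\<tau>, \<tau>]\<close>, are nonzero and enclose an angle of at most \<open>\<pi>/2\<close>.

  After a rotation the \<open>u\<^sub>l\<close> lie in the closed first quadrant (\<open>non_obtuse_in_quadrant\<close>).
  The angle budget \<open>\<pi>/2\<close> is then spent as follows. The real parts of the
  coefficients scale each of the two coordinates of \<open>\<Sum> u\<^sub>l\<close> by a factor in
  \<open>[1 - \<eta>, 1 + \<eta>]\<close>, and two vectors obtained in this way differ in direction by at most
  \<open>2 arctan \<eta>\<close> (\<open>abs_Arg_mult_cnj_le\<close>). The imaginary parts add to each of them a vector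
  at most \<open>\<tau> / (1 - \<eta>) = sin (\<pi>/4 - arctan \<eta>)\<close> times as long, which turns it by at most
  \<open>\<pi>/4 - arctan \<eta>\<close> (\<open>abs_Arg_one_plus_le\<close>). The total is
  \<open>2 arctan \<eta> + 2 (\<pi>/4 - arctan \<eta>) = \<pi>/2\<close>, which explains the value of \<open>\<tau>\<close>.
\<close>

section \<open>Expansion along a vertex\<close>

text \<open>
  This is the hafnian with an arbitrary vertex set in place of an initial segment of the
  naturals, so that deleting vertices requires no reindexing. The weight is a function of the
  unordered pair, which builds in the symmetry of the matrix.
\<close>

definition pairing_sum :: "('a set \<Rightarrow> 'b::comm_ring_1) \<Rightarrow> 'a set \<Rightarrow> 'b" where
  "pairing_sum f A = (\<Sum>M\<in>pairings A. \<Prod>P\<in>M. f P)"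

lemma pairing_sum_empty [simp]:
  fixes f :: "'a set \<Rightarrow> 'b::comm_ring_1"
  shows "pairing_sum f {} = 1"
proof -
  have "pairings {} = {{} :: 'a set set}"
    by (auto simp: pairings_def partition_on_def)
  then show ?thesis
    by (simp add: pairing_sum_def)
qed

lemma insert_pairing:
  assumes "i \<in> A" "j \<in> A" "i \<noteq> j" "M \<in> pairings (A - {i, j})"
  shows "insert {i, j} M \<in> pairings A"
proof -
  have "partition_on (A - {i, j}) M" and c: "\<forall>P\<in>M. card P = 2"
    using assms(4) by (auto simp: pairings_def)
  then have "\<Union>M = A - {i, j}" "disjoint M" "{} \<notin> M"
    by (auto simp: partition_on_def)
  then have "partition_on A (insert {i, j} M)"
    using assms(1,2) unfolding partition_on_def disjoint_def by auto
  then show ?thesis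
    using c assms(3) by (auto simp: pairings_def)
qed

lemma remove_pairing:
  assumes "M \<in> pairings A" "i \<in> A"
  obtains j N where "j \<in> A - {i}" "N \<in> pairings (A - {i, j})" "M = insert {i, j} N"
proof -
  have p: "\<Union>M = A" "disjoint M" "{} \<notin> M" and c: "\<forall>P\<in>M. card P = 2"
    using assms(1) by (auto simp: pairings_def partition_on_def)
  obtain P where P: "P \<in> M" "i \<in> P"
    using p(1) assms(2) by blast
  have "card P = 2"
    using P c by auto
  then obtain j where j: "P = {i, j}" "j \<noteq> i"
    using P(2) by (auto simp: card_2_iff)
  have disj: "Q \<inter> P = {}" if "Q \<in> M - {P}" for Q
    using p(2) P(1) that by (auto simp: disjoint_def)
  have "\<Union>(M - {P}) = A - P"
    using p(1) P(1) disj by blast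
  then have "partition_on (A - {i, j}) (M - {P})"
    using p(2,3) j(1) by (auto simp: partition_on_def disjoint_def)
  then have "M - {P} \<in> pairings (A - {i, j})"
    using c by (auto simp: pairings_def)
  moreover have "M = insert {i, j} (M - {P})" "j \<in> A - {i}"
    using P j p(1) by auto
  ultimately show ?thesis
    using that by blast
qed

lemma notin_pairing:
  assumes "M \<in> pairings A" "i \<notin> A" "P \<in> M"
  shows "i \<notin> P"
  using assms by (auto simp: pairings_def partition_on_def)

text \<open>
  A pairing of \<open>A\<close> is determined by the partner \<open>j\<close> of \<open>i\<close> and a pairing of the other vertices,
  hence the pairings of \<open>A\<close> split into disjoint classes according to \<open>j\<close>.
\<close>

lemma pairing_sum_expand:
  assumes "finite A" "i \<in> A"
  shows "pairing_sum f A = (\<Sum>j\<in>A - {i}. f {i, j} * pairing_sum f (A - {i, j}))"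
proof -
  let ?S = "\<lambda>j. insert {i, j} ` pairings (A - {i, j})"
  have fin: "finite (pairings (A - {i, j}))" for j
    using assms(1) by (simp add: finite_pairings)
  have new: "{i, j} \<notin> M" if "M \<in> pairings (A - {i, k})" for j k M
    using notin_pairing[OF that, of i "{i, j}"] by auto
  have split: "pairings A = (\<Union>j\<in>A - {i}. ?S j)"
  proof (intro equalityI subsetI)
    fix M assume "M \<in> pairings A"
    then show "M \<in> (\<Union>j\<in>A - {i}. ?S j)"
      using assms(2) by (rule remove_pairing) blast
  next
    fix M assume "M \<in> (\<Union>j\<in>A - {i}. ?S j)"
    then obtain j N where "j \<in> A" "j \<noteq> i" "N \<in> pairings (A - {i, j})" "M = insert {i, j} N"
      by blast
    then show "M \<in> pairings A"
      using insert_pairing[of i A j N] assms(2) by simp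
  qed
  have disj: "?S j \<inter> ?S k = {}" if "j \<in> A - {i}" "k \<in> A - {i}" "j \<noteq> k" for j k
  proof -
    have False if "M \<in> pairings (A - {i, j})" "N \<in> pairings (A - {i, k})"
        "insert {i, j} M = insert {i, k} N" for M N
    proof -
      have "{i, j} = {i, k}"
        using that new[OF that(2), of j] by blast
      then show False
        using \<open>j \<noteq> k\<close> by (auto simp: doubleton_eq_iff)
    qed
    then show ?thesis
      by blast
  qed
  have inj: "inj_on (insert {i, j}) (pairings (A - {i, j}))" for j
    by (intro inj_onI) (metis new insert_ident)
  have finM: "finite M" if "M \<in> pairings (A - {i, j})" for M j
    using that assms(1) finite_elements[of "A - {i, j}" M] by (auto simp: pairings_def)
  have "pairing_sum f A = (\<Sum>j\<in>A - {i}. \<Sum>M\<in>?S j. \<Prod>P\<in>M. f P)"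
    unfolding pairing_sum_def split
    by (rule sum.UNION_disjoint) (use assms(1) fin disj in auto)
  also have "\<dots> = (\<Sum>j\<in>A - {i}. \<Sum>M\<in>pairings (A - {i, j}). f {i, j} * (\<Prod>P\<in>M. f P))"
  proof (rule sum.cong[OF refl])
    fix j
    have "(\<Sum>M\<in>?S j. \<Prod>P\<in>M. f P) = (\<Sum>M\<in>pairings (A - {i, j}). \<Prod>P\<in>insert {i, j} M. f P)"
      by (simp only: sum.reindex[OF inj] o_def)
    also have "\<dots> = (\<Sum>M\<in>pairings (A - {i, j}). f {i, j} * (\<Prod>P\<in>M. f P))"
      by (intro sum.cong refl prod.insert finM new)
    finally show "(\<Sum>M\<in>?S j. \<Prod>P\<in>M. f P) = (\<Sum>M\<in>pairings (A - {i, j}). f {i, j} * (\<Prod>P\<in>M. f P))" .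
  qed
  finally show ?thesis
    by (simp add: pairing_sum_def sum_distrib_left)
qed

section \<open>Sums of vectors with pairwise non-obtuse angles\<close>

text \<open>
  Angles are measured by the principal argument. This criterion turns an estimate of
  coordinates into one of angles.
\<close>

lemma abs_Arg_le:
  assumes "0 \<le> \<beta>" "\<beta> < pi / 2" "Re w > 0" "\<bar>Im w\<bar> \<le> tan \<beta> * Re w"
  shows "\<bar>Arg w\<bar> \<le> \<beta>"
proof (rule ccontr)
  assume "\<not> \<bar>Arg w\<bar> \<le> \<beta>"
  moreover have a: "\<bar>Arg w\<bar> < pi / 2"
    using assms(3) Arg_Re_pos[of w] by blast
  ultimately have "tan \<beta> < tan \<bar>Arg w\<bar>"
    using assms(1) by (intro tan_monotone) auto
  also have "tan \<bar>Arg w\<bar> = \<bar>tan (Arg w)\<bar>"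
    using a tan_pos_pi2_le[of "Arg w"] tan_pos_pi2_le[of "- Arg w"] by (auto simp: abs_if)
  also have "tan (Arg w) = Im w / Re w"
  proof -
    have "w = rcis (cmod w) (Arg w)"
      by (simp add: rcis_cmod_Arg)
    then have "Re w = cmod w * cos (Arg w)" "Im w = cmod w * sin (Arg w)"
      by (metis Re_rcis, metis Im_rcis)
    then show ?thesis
      using assms(3) by (auto simp: tan_def)
  qed
  finally show False
    using assms(3,4) by (simp add: abs_divide pos_less_divide_eq)
qed

text \<open>
  Angles add up under multiplication, so the product stays in the right half-plane as long as
  the total turn is at most a right angle.
\<close>

lemma Re_mult_nonneg:
  assumes "\<bar>Arg w\<bar> + \<bar>Arg w'\<bar> + \<bar>Arg w''\<bar> \<le> pi / 2"
  shows "Re (w * w' * w'') \<ge> 0"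
proof -
  have "w * w' * w'' = rcis (cmod w) (Arg w) * rcis (cmod w') (Arg w') * rcis (cmod w'') (Arg w'')"
    by (simp add: rcis_cmod_Arg)
  also have "\<dots> = rcis (cmod w * cmod w' * cmod w'') (Arg w + Arg w' + Arg w'')"
    by (simp add: rcis_mult)
  finally have "Re (w * w' * w'') = cmod w * cmod w' * cmod w'' * cos (Arg w + Arg w' + Arg w'')"
    by simp
  moreover have "cos (Arg w + Arg w' + Arg w'') \<ge> 0"
    using assms by (intro cos_ge_zero) auto
  ultimately show ?thesis
    by simp
qed

text \<open>
  The disc of radius \<open>sin \<beta>\<close> around 1 is tangent to the two rays from 0 at angles \<open>\<plusminus> \<beta>\<close>.
\<close>

lemma abs_Arg_one_plus_le:
  assumes "0 \<le> \<beta>" "\<beta> < pi / 2" "cmod z \<le> sin \<beta>"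
  shows "Re (1 + z) > 0" "\<bar>Arg (1 + z)\<bar> \<le> \<beta>"
proof -
  define c where "c = cos \<beta>"
  define s where "s = sin \<beta>"
  have c: "c > 0"
    unfolding c_def using assms(1,2) by (intro cos_gt_zero_pi) auto
  have s: "s \<ge> 0"
    unfolding s_def using assms(1,2) by (intro sin_ge_zero) auto
  have cs: "c\<^sup>2 = 1 - s\<^sup>2"
    by (simp add: c_def s_def cos_squared_eq)
  then have "s\<^sup>2 < 1\<^sup>2"
    using c by (smt (verit) one_power2 zero_less_power)
  then have "s < 1"
    by (rule power2_less_imp_less) simp
  then show pos: "Re (1 + z) > 0"
    using assms(3) abs_Re_le_cmod[of z] by (simp add: s_def)
  have "(cmod z)\<^sup>2 \<le> s\<^sup>2"
    using assms(3) by (intro power_mono) (auto simp: s_def)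
  then have z: "(Re z)\<^sup>2 + (Im z)\<^sup>2 \<le> s\<^sup>2"
    by (simp add: cmod_power2)
  have "(Im z)\<^sup>2 * c\<^sup>2 \<le> (s\<^sup>2 - (Re z)\<^sup>2) * c\<^sup>2"
    using z by (intro mult_right_mono) auto
  \<comment> \<open>The square that is split off vanishes on the line through the two points of tangency.\<close>
  also have "\<dots> = s\<^sup>2 * (1 + Re z)\<^sup>2 - (Re z + s\<^sup>2)\<^sup>2"
    unfolding cs by (simp add: power2_eq_square algebra_simps)
  also have "\<dots> \<le> s\<^sup>2 * (1 + Re z)\<^sup>2"
    by simp
  finally have "(\<bar>Im z\<bar> * c)\<^sup>2 \<le> (s * (1 + Re z))\<^sup>2"
    by (simp add: power_mult_distrib)
  then have "\<bar>Im z\<bar> * c \<le> s * (1 + Re z)"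
    by (rule power2_le_imp_le) (use pos s in simp)
  then have "\<bar>Im z\<bar> \<le> s * (1 + Re z) / c"
    using c by (simp only: pos_le_divide_eq)
  moreover have "tan \<beta> = s / c"
    by (simp add: tan_def s_def c_def)
  ultimately have "\<bar>Im (1 + z)\<bar> \<le> tan \<beta> * Re (1 + z)"
    by simp
  then show "\<bar>Arg (1 + z)\<bar> \<le> \<beta>"
    by (rule abs_Arg_le[OF assms(1,2) pos])
qed

text \<open>
  All directions lie within \<open>\<pi>/2\<close> of a fixed vector \<open>u l\<close>; let \<open>u m\<close> be the clockwise-most one.
  Every other vector is then reached from \<open>u m\<close> by a counterclockwise turn of at most \<open>\<pi>\<close>.
  Together with the hypothesis on the real parts this puts all \<open>u k * cnj (u m)\<close> into the
  closed first quadrant.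
\<close>

lemma non_obtuse_in_quadrant:
  fixes u :: "'a \<Rightarrow> complex"
  assumes "finite J" "J \<noteq> {}" "\<forall>j\<in>J. u j \<noteq> 0"
    and "\<forall>j\<in>J. \<forall>k\<in>J. Re (u j * cnj (u k)) \<ge> 0"
  shows "\<exists>m\<in>J. \<forall>k\<in>J. Im (u k * cnj (u m)) \<ge> 0"
proof -
  obtain l where l: "l \<in> J"
    using assms(2) by blast
  then have ul: "u l \<noteq> 0"
    using assms(3) by blast
  define t where "t k = Arg (u k * cnj (u l))" for k
  obtain m where m: "m \<in> J" "\<And>k. k \<in> J \<Longrightarrow> t m \<le> t k"
    using arg_min_if_finite[OF assms(1,2), of t] by (metis linorder_not_le)
  have "Im (u k * cnj (u m)) \<ge> 0" if k: "k \<in> J" for k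
  proof -
    have bd: "\<bar>t j\<bar> \<le> pi / 2" if "j \<in> J" for j
      using assms(4)[rule_format, OF that l] Arg_Re_nonneg[of "u j * cnj (u l)"] by (simp only: t_def)
    have e: "u j * cnj (u l) = rcis (cmod (u j * cnj (u l))) (t j)" for j
      by (simp add: t_def rcis_cmod_Arg)
    have "(u k * cnj (u m)) * (cmod (u l))\<^sup>2 = (u k * cnj (u l)) * cnj (u m * cnj (u l))"
      using complex_norm_square[of "u l"] by (simp add: mult_ac)
    also have "\<dots> = rcis (cmod (u k * cnj (u l)) * cmod (u m * cnj (u l))) (t k - t m)"
    proof -
      have "cnj (rcis r x) = rcis r (- x)" for r x
        by (simp add: rcis_def cis_cnj)
      then show ?thesis
        by (subst (1 2) e) (simp add: rcis_mult)
    qed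
    finally have "Im ((u k * cnj (u m)) * (cmod (u l))\<^sup>2)
        = cmod (u k * cnj (u l)) * cmod (u m * cnj (u l)) * sin (t k - t m)"
      by simp
    moreover have "sin (t k - t m) \<ge> 0"
      using m k bd[OF k] bd[OF m(1)] by (intro sin_ge_zero) auto
    ultimately have "Im (u k * cnj (u m)) * (cmod (u l))\<^sup>2 \<ge> 0"
      by (simp flip: of_real_power)
    moreover have "0 < (cmod (u l))\<^sup>2"
      using ul by simp
    ultimately show ?thesis
      by (metis mult_nonneg_nonneg zero_le_mult_iff not_less)
  qed
  with m(1) show ?thesis
    by blast
qed

text \<open>
  Divide by the dot product \<open>a a' + b b'\<close>: the tangent of the angle between \<open>(a, b)\<close> and \<open>(a', b')\<close>
  is at most \<open>(q - 1/q) / 2\<close>. With \<open>s\<^sup>2 = a b'\<close> and \<open>t\<^sup>2 = a' b\<close>, the dot product is at least \<open>2 s t\<close>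
  by the inequality of arithmetic and geometric means, while \<open>s \<le> q t\<close> bounds the cross product
  \<open>s\<^sup>2 - t\<^sup>2\<close> by \<open>(q - 1/q) s t\<close>.
\<close>

lemma cross_le_dot:
  fixes a b a' b' q :: real
  assumes "q \<ge> 1" "0 \<le> a" "0 \<le> b" "0 \<le> a'" "0 \<le> b'" "a \<le> q * a'" "b' \<le> q * b"
  shows "2 * (a * b' - a' * b) \<le> (q - 1 / q) * (a * a' + b * b')"
proof -
  define s where "s = sqrt (a * b')"
  define t where "t = sqrt (a' * b)"
  have s2: "s\<^sup>2 = a * b'" and t2: "t\<^sup>2 = a' * b" and s0: "s \<ge> 0" and t0: "t \<ge> 0"
    using assms by (auto simp: s_def t_def)
  have "a * b' \<le> (q * a') * (q * b)"
    using assms by (intro mult_mono) auto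
  then have "s\<^sup>2 \<le> (q * t)\<^sup>2"
    by (simp add: s2 power_mult_distrib t2 power2_eq_square[of q] mult_ac)
  then have "s \<le> q * t"
    by (rule power2_le_imp_le) (use assms t0 in auto)
  then have "(s - q * t) * (s + t / q) \<le> 0"
    using assms s0 t0 by (intro mult_nonpos_nonneg) auto
  also have "(s - q * t) * (s + t / q) = s\<^sup>2 - t\<^sup>2 - (q - 1 / q) * (s * t)"
    using assms(1) by (simp add: field_simps power2_eq_square)
  finally have 1: "2 * (s\<^sup>2 - t\<^sup>2) \<le> (q - 1 / q) * (2 * (s * t))"
    by simp
  have "(2 * (s * t))\<^sup>2 = 4 * (a * a') * (b * b')"
    by (simp add: power_mult_distrib s2 t2 mult_ac)
  also have "\<dots> \<le> (a * a' + b * b')\<^sup>2"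
    using sum_squares_ge_zero[of "a * a' - b * b'" 0] by (simp add: power2_eq_square algebra_simps)
  finally have "2 * (s * t) \<le> a * a' + b * b'"
    by (rule power2_le_imp_le) (use assms in auto)
  moreover have "1 / q \<le> 1"
    using assms(1) by simp
  then have "q - 1 / q \<ge> 0"
    using assms(1) by linarith
  ultimately have "(q - 1 / q) * (2 * (s * t)) \<le> (q - 1 / q) * (a * a' + b * b')"
    by (rule mult_left_mono)
  with 1 show ?thesis
    by (simp add: s2 t2)
qed

lemma weighted_sum_bounds:
  fixes a x :: "'a \<Rightarrow> real"
  assumes "\<And>j. j \<in> J \<Longrightarrow> \<bar>1 - a j\<bar> \<le> \<eta>" "\<And>j. j \<in> J \<Longrightarrow> 0 \<le> x j"
  shows "(1 - \<eta>) * sum x J \<le> (\<Sum>j\<in>J. a j * x j)" "(\<Sum>j\<in>J. a j * x j) \<le> (1 + \<eta>) * sum x J"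
proof -
  have a: "1 - \<eta> \<le> a j" "a j \<le> 1 + \<eta>" if "j \<in> J" for j
    using assms(1)[OF that] by linarith+
  show "(1 - \<eta>) * sum x J \<le> (\<Sum>j\<in>J. a j * x j)"
    unfolding sum_distrib_left by (intro sum_mono mult_right_mono a(1) assms(2))
  show "(\<Sum>j\<in>J. a j * x j) \<le> (1 + \<eta>) * sum x J"
    unfolding sum_distrib_left by (intro sum_mono mult_right_mono a(2) assms(2))
qed

text \<open>
  The coordinates of \<open>v\<close> and \<open>w\<close> differ by factors of at most \<open>q = (1 + \<eta>) / (1 - \<eta>)\<close> in either
  direction, and \<open>(q - 1/q) / 2 = 2 \<eta> / (1 - \<eta>\<^sup>2)\<close> is the tangent of \<open>2 arctan \<eta>\<close>. Comparing \<open>v\<close> with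
  \<open>w\<close> directly matters: for suitable \<open>X\<close> and \<open>Y\<close>, a vector with these bounds lies at
  the angle \<open>arcsin \<eta>\<close> from \<open>(X, Y)\<close>, so that going through \<open>(X, Y)\<close> would only give the bound \<open>2 arcsin \<eta>\<close>.
\<close>

lemma abs_Arg_mult_cnj_le:
  fixes \<eta> :: real
  assumes "0 \<le> \<eta>" "\<eta> < 1" "0 < X" "0 \<le> Y"
    and v: "(1 - \<eta>) * X \<le> Re v" "Re v \<le> (1 + \<eta>) * X" "(1 - \<eta>) * Y \<le> Im v" "Im v \<le> (1 + \<eta>) * Y"
    and w: "(1 - \<eta>) * X \<le> Re w" "Re w \<le> (1 + \<eta>) * X" "(1 - \<eta>) * Y \<le> Im w" "Im w \<le> (1 + \<eta>) * Y"
  shows "\<bar>Arg (v * cnj w)\<bar> \<le> 2 * arctan \<eta>"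
proof -
  define q where "q = (1 + \<eta>) / (1 - \<eta>)"
  have q1: "q \<ge> 1"
    using assms(1,2) by (simp add: q_def)
  have q: "r \<le> q * r'" if "r \<le> (1 + \<eta>) * x" "(1 - \<eta>) * x \<le> r'" for r r' x
  proof -
    have "x \<le> r' / (1 - \<eta>)"
      using that(2) assms(2) by (simp add: field_simps)
    then have "(1 + \<eta>) * x \<le> (1 + \<eta>) * (r' / (1 - \<eta>))"
      using assms(1) by (intro mult_left_mono) auto
    then show ?thesis
      using that(1) by (simp add: q_def)
  qed
  have "0 < (1 - \<eta>) * X" "0 \<le> (1 - \<eta>) * Y"
    using assms(2,3,4) by auto
  then have pos: "Re v > 0" "Re w > 0" "Im v \<ge> 0" "Im w \<ge> 0"
    using v w by linarith+
  have "2 * (Re v * Im w - Re w * Im v) \<le> (q - 1 / q) * (Re v * Re w + Im v * Im w)"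
    by (rule cross_le_dot[OF q1]) (use pos in \<open>auto intro: q v w\<close>)
  moreover have "2 * (Re w * Im v - Re v * Im w) \<le> (q - 1 / q) * (Re w * Re v + Im w * Im v)"
    by (rule cross_le_dot[OF q1]) (use pos in \<open>auto intro: q v w\<close>)
  ultimately have "2 * \<bar>Im (v * cnj w)\<bar> \<le> (q - 1 / q) * Re (v * cnj w)"
    by (simp add: abs_if mult_ac)
  moreover have "(q - 1 / q) / 2 = tan (2 * arctan \<eta>)"
  proof -
    have "1 - \<eta>\<^sup>2 = (1 - \<eta>) * (1 + \<eta>)"
      by (simp add: power2_eq_square algebra_simps)
    then have "(q - 1 / q) / 2 = 2 * \<eta> / (1 - \<eta>\<^sup>2)"
      using assms(1,2) by (simp add: q_def divide_simps) (simp add: algebra_simps power2_eq_square)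
    also have "\<dots> = tan (2 * arctan \<eta>)"
      using assms(1,2) by (simp add: arctan_double tan_arctan)
    finally show ?thesis .
  qed
  ultimately have "\<bar>Im (v * cnj w)\<bar> \<le> tan (2 * arctan \<eta>) * Re (v * cnj w)"
    by (simp flip: \<open>(q - 1 / q) / 2 = _\<close>)
  moreover have "Re (v * cnj w) > 0"
    using pos by (simp add: add_pos_nonneg)
  moreover have "2 * arctan \<eta> < pi / 2"
    using arctan_less_iff[of \<eta> 1] assms(2) by (simp add: arctan_one)
  ultimately show ?thesis
    using assms(1) by (intro abs_Arg_le) auto
qed

text \<open>
  Here \<open>v\<close> is the combination with the real parts of the coefficients, and \<open>d\<close> is the turn caused
  by the imaginary parts. Since all \<open>p j\<close> lie in the first quadrant, sums can be
  compared coordinatewise.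
\<close>

lemma perturbed_sum_in_quadrant:
  fixes p c :: "'a \<Rightarrow> complex" and \<eta> \<tau> :: real
  assumes eta: "0 \<le> \<eta>" "\<eta> < 1"
    and tau: "\<tau> = (1 - \<eta>) * sin (pi / 4 - arctan \<eta>)"
    and p: "\<forall>j\<in>J. 0 \<le> Re (p j) \<and> 0 \<le> Im (p j)" and X: "0 < Re (sum p J)"
    and c: "\<forall>j\<in>J. \<bar>1 - Re (c j)\<bar> \<le> \<eta> \<and> \<bar>Im (c j)\<bar> \<le> \<tau>"
  obtains v d where "(\<Sum>j\<in>J. c j * p j) = v * d"
    "(1 - \<eta>) * Re (sum p J) \<le> Re v" "Re v \<le> (1 + \<eta>) * Re (sum p J)"
    "(1 - \<eta>) * Im (sum p J) \<le> Im v" "Im v \<le> (1 + \<eta>) * Im (sum p J)"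
    "Re d > 0" "\<bar>Arg d\<bar> \<le> pi / 4 - arctan \<eta>"
proof -
  define \<beta> where "\<beta> = pi / 4 - arctan \<eta>"
  have "arctan \<eta> < pi / 4"
    using arctan_less_iff[of \<eta> 1] eta(2) unfolding arctan_one by blast
  then have beta: "0 \<le> \<beta>" "\<beta> < pi / 2"
    using zero_le_arctan_iff[of \<eta>] eta(1) pi_gt_zero unfolding \<beta>_def by linarith+
  have sin0: "sin \<beta> \<ge> 0"
    using beta by (intro sin_ge_zero) auto
  define v where "v = (\<Sum>j\<in>J. of_real (Re (c j)) * p j)"
  define w where "w = (\<Sum>j\<in>J. of_real (Im (c j)) * p j)"
  have vw: "Re v = (\<Sum>j\<in>J. Re (c j) * Re (p j))" "Im v = (\<Sum>j\<in>J. Re (c j) * Im (p j))"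
    "Re w = (\<Sum>j\<in>J. Im (c j) * Re (p j))" "Im w = (\<Sum>j\<in>J. Im (c j) * Im (p j))"
    by (simp_all add: v_def w_def)
  have v: "(1 - \<eta>) * Re (sum p J) \<le> Re v" "Re v \<le> (1 + \<eta>) * Re (sum p J)"
    "(1 - \<eta>) * Im (sum p J) \<le> Im v" "Im v \<le> (1 + \<eta>) * Im (sum p J)"
    unfolding vw Re_sum Im_sum by (rule weighted_sum_bounds; use p c in blast)+
  have small: "\<bar>\<Sum>j\<in>J. Im (c j) * x j\<bar> \<le> sin \<beta> * r"
    if "\<forall>j\<in>J. 0 \<le> x j" "(1 - \<eta>) * sum x J \<le> r" for x r
  proof -
    have "\<bar>\<Sum>j\<in>J. Im (c j) * x j\<bar> \<le> (\<Sum>j\<in>J. \<bar>Im (c j) * x j\<bar>)"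
      by (rule sum_abs)
    also have "\<dots> \<le> (\<Sum>j\<in>J. \<tau> * x j)"
      using that(1) c by (intro sum_mono) (simp add: abs_mult mult_right_mono)
    also have "\<dots> = sin \<beta> * ((1 - \<eta>) * sum x J)"
      by (simp add: tau \<beta>_def flip: sum_distrib_left)
    also have "\<dots> \<le> sin \<beta> * r"
      using that(2) sin0 by (rule mult_left_mono)
    finally show ?thesis .
  qed
  have wv: "\<bar>Re w\<bar> \<le> sin \<beta> * Re v" "\<bar>Im w\<bar> \<le> sin \<beta> * Im v"
    unfolding vw(3,4) using p v(1,3) by (intro small; simp)+
  have "(cmod w)\<^sup>2 \<le> (sin \<beta> * cmod v)\<^sup>2"
    using power_mono[OF wv(1) abs_ge_zero, of 2] power_mono[OF wv(2) abs_ge_zero, of 2]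
    by (simp add: cmod_power2 power_mult_distrib distrib_left)
  then have le: "cmod w \<le> sin \<beta> * cmod v"
    by (rule power2_le_imp_le) (simp add: sin0)
  have "0 < (1 - \<eta>) * Re (sum p J)"
    by (rule mult_pos_pos) (use X eta(2) in linarith)+
  then have v0: "v \<noteq> 0"
    using v(1) by auto
  have "cmod (\<i> * w / v) \<le> sin \<beta>"
    using le v0 by (simp add: norm_mult norm_divide pos_divide_le_eq)
  note d = abs_Arg_one_plus_le[OF beta this]
  have "c j * p j = of_real (Re (c j)) * p j + \<i> * (of_real (Im (c j)) * p j)" for j
    by (simp add: complex_eq_iff)
  then have "(\<Sum>j\<in>J. c j * p j) = (\<Sum>j\<in>J. of_real (Re (c j)) * p j + \<i> * (of_real (Im (c j)) * p j))"
    by (rule sum.cong[OF refl])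
  also have "\<dots> = v + \<i> * w"
    by (simp only: v_def w_def sum.distrib sum_distrib_left)
  also have "\<dots> = v * (1 + \<i> * w / v)"
    using v0 by (simp add: distrib_left)
  finally show ?thesis
    by (rule that[OF _ v d(1) d(2)[unfolded \<beta>_def]])
qed

text \<open>
  Up to the common rotation by \<open>u m\<close> the two sums are \<open>v * d\<close> and \<open>v' * d'\<close>, with \<open>v\<close> and \<open>v'\<close>
  at an angle of at most \<open>2 arctan \<eta>\<close>, and \<open>d\<close> and \<open>d'\<close> contributing at most
  \<open>\<pi>/4 - arctan \<eta>\<close> each.
\<close>

lemma perturbed_sums:
  fixes u z z' :: "'a \<Rightarrow> complex" and \<eta> \<tau> :: real
  assumes eta: "0 \<le> \<eta>" "\<eta> < 1"
    and tau: "\<tau> = (1 - \<eta>) * sin (pi / 4 - arctan \<eta>)"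
    and J: "finite J" "J \<noteq> {}"
    and u: "\<forall>j\<in>J. u j \<noteq> 0" "\<forall>j\<in>J. \<forall>k\<in>J. Re (u j * cnj (u k)) \<ge> 0"
    and z: "\<forall>j\<in>J. \<bar>1 - Re (z j)\<bar> \<le> \<eta> \<and> \<bar>Im (z j)\<bar> \<le> \<tau>"
    and z': "\<forall>j\<in>J. \<bar>1 - Re (z' j)\<bar> \<le> \<eta> \<and> \<bar>Im (z' j)\<bar> \<le> \<tau>"
  shows "(\<Sum>j\<in>J. z j * u j) \<noteq> 0"
    and "Re ((\<Sum>j\<in>J. z j * u j) * cnj (\<Sum>j\<in>J. z' j * u j)) \<ge> 0"
proof -
  obtain m where m: "m \<in> J" "\<forall>k\<in>J. Im (u k * cnj (u m)) \<ge> 0"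
    using non_obtuse_in_quadrant[OF J u] by (rule bexE)
  then have um: "u m \<noteq> 0"
    using u(1) by blast
  define p where "p j = u j * cnj (u m)" for j
  have p: "\<forall>j\<in>J. 0 \<le> Re (p j) \<and> 0 \<le> Im (p j)"
    using u(2) m unfolding p_def by blast
  have "p m = (cmod (u m))\<^sup>2"
    by (simp only: p_def complex_norm_square)
  then have "Re (p m) = (cmod (u m))\<^sup>2"
    by (simp only: Re_complex_of_real)
  then have "0 < Re (p m)"
    using um by simp
  also have "\<dots> \<le> (\<Sum>j\<in>J. Re (p j))"
    using J(1) m(1) p by (intro member_le_sum) auto
  finally have X: "0 < Re (sum p J)"
    by simp
  have Y: "0 \<le> Im (sum p J)"
    using p by (simp add: sum_nonneg)
  obtain v d where v: "(\<Sum>j\<in>J. z j * p j) = v * d"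
    "(1 - \<eta>) * Re (sum p J) \<le> Re v" "Re v \<le> (1 + \<eta>) * Re (sum p J)"
    "(1 - \<eta>) * Im (sum p J) \<le> Im v" "Im v \<le> (1 + \<eta>) * Im (sum p J)"
    and d: "Re d > 0" "\<bar>Arg d\<bar> \<le> pi / 4 - arctan \<eta>"
    by (rule perturbed_sum_in_quadrant[OF eta tau p X z])
  obtain v' d' where v': "(\<Sum>j\<in>J. z' j * p j) = v' * d'"
    "(1 - \<eta>) * Re (sum p J) \<le> Re v'" "Re v' \<le> (1 + \<eta>) * Re (sum p J)"
    "(1 - \<eta>) * Im (sum p J) \<le> Im v'" "Im v' \<le> (1 + \<eta>) * Im (sum p J)"
    and d': "Re d' > 0" "\<bar>Arg d'\<bar> \<le> pi / 4 - arctan \<eta>"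
    by (rule perturbed_sum_in_quadrant[OF eta tau p X z'])
  define S where "S = (\<Sum>j\<in>J. z j * u j)"
  define S' where "S' = (\<Sum>j\<in>J. z' j * u j)"
  have S: "S * cnj (u m) = v * d" and S': "S' * cnj (u m) = v' * d'"
    unfolding S_def S'_def v(1)[symmetric] v'(1)[symmetric] p_def
    by (simp_all only: sum_distrib_right mult.assoc)
  have "0 < (1 - \<eta>) * Re (sum p J)"
    by (rule mult_pos_pos) (use X eta(2) in linarith)+
  then have "v * d \<noteq> 0"
    using v(2) d(1) by auto
  then have "S \<noteq> 0"
    using S by auto
  then show "(\<Sum>j\<in>J. z j * u j) \<noteq> 0"
    unfolding S_def .
  have "\<bar>Arg (v * cnj v')\<bar> \<le> 2 * arctan \<eta>"
    by (rule abs_Arg_mult_cnj_le[OF eta X Y v(2-5) v'(2-5)])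
  moreover have "\<bar>Arg (cnj d')\<bar> \<le> pi / 4 - arctan \<eta>"
    using d'(2) by (simp add: Arg_cnj)
  ultimately have "Re (v * cnj v' * d * cnj d') \<ge> 0"
    using d(2) by (intro Re_mult_nonneg) linarith
  also have "v * cnj v' * d * cnj d' = (v * d) * cnj (v' * d')"
    by (simp add: mult_ac)
  also have "\<dots> = (S * cnj S') * (u m * cnj (u m))"
    unfolding S[symmetric] S'[symmetric] by (simp add: mult_ac)
  also have "\<dots> = of_real ((cmod (u m))\<^sup>2) * (S * cnj S')"
    by (simp only: complex_norm_square mult.commute)
  finally have "0 \<le> (cmod (u m))\<^sup>2 * Re (S * cnj S')"
    by (simp only: Re_complex_of_real Im_complex_of_real times_complex.sel)
  moreover have "0 < (cmod (u m))\<^sup>2"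
    using um by simp
  ultimately have "0 \<le> Re (S * cnj S')"
    by (simp only: zero_le_mult_iff) linarith
  then show "Re ((\<Sum>j\<in>J. z j * u j) * cnj (\<Sum>j\<in>J. z' j * u j)) \<ge> 0"
    unfolding S_def S'_def .
qed

section \<open>Induction on the number of vertices\<close>

text \<open>
  The two conclusions are proved simultaneously: at each step the expansion along \<open>j\<close> (and \<open>k\<close>)
  produces the sums of \<open>perturbed_sums\<close>, whose hypotheses on the vectors
  \<open>pairing_sum f (C - {l})\<close> are exactly the two conclusions for \<open>m\<close>.
\<close>

lemma pairing_sum_nonzero_non_obtuse:
  fixes f :: "'a set \<Rightarrow> complex" and \<eta> \<tau> :: real
  assumes eta: "0 \<le> \<eta>" "\<eta> < 1"
    and tau: "\<tau> = (1 - \<eta>) * sin (pi / 4 - arctan \<eta>)"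
    and f: "\<forall>i\<in>V. \<forall>j\<in>V. \<bar>1 - Re (f {i, j})\<bar> \<le> \<eta> \<and> \<bar>Im (f {i, j})\<bar> \<le> \<tau>"
  shows "(\<forall>A\<subseteq>V. finite A \<and> card A = 2 * m \<longrightarrow> pairing_sum f A \<noteq> 0) \<and>
    (\<forall>C\<subseteq>V. \<forall>j\<in>V - C. \<forall>k\<in>V - C. finite C \<and> Suc (card C) = 2 * m \<longrightarrow>
      Re (pairing_sum f (insert j C) * cnj (pairing_sum f (insert k C))) \<ge> 0)"
proof (induction m)
  case 0
  then show ?case
    by auto
next
  case (Suc m)
  \<comment> \<open>For a one-element \<open>C\<close> (the step from \<open>m = 0\<close>) the only vector is the empty pairing sum 1,
    and there are no two vectors to compare.\<close>
  have sub: "(\<Sum>l\<in>C. f {j, l} * pairing_sum f (C - {l})) \<noteq> 0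
      \<and> Re ((\<Sum>l\<in>C. f {j, l} * pairing_sum f (C - {l})) *
          cnj (\<Sum>l\<in>C. f {k, l} * pairing_sum f (C - {l}))) \<ge> 0"
    if C: "C \<subseteq> V" "finite C" "card C = Suc (2 * m)" and jk: "j \<in> V" "k \<in> V" for C j k
  proof -
    have ne: "C \<noteq> {}"
      using C(3) by auto
    have "pairing_sum f (C - {l}) \<noteq> 0" if "l \<in> C" for l
      by (rule Suc.IH[THEN conjunct1, rule_format]) (use C that in auto)
    then have u: "\<forall>l\<in>C. pairing_sum f (C - {l}) \<noteq> 0"
      by blast
    have "Re (pairing_sum f (C - {l}) * cnj (pairing_sum f (C - {l'}))) \<ge> 0"
      if l: "l \<in> C" "l' \<in> C" for l l'
    proof (cases "l = l'")
      case True
      then show ?thesis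
        by simp
    next
      case False
      \<comment> \<open>The two sets share all vertices of \<open>D\<close> and differ only in \<open>l\<close> and \<open>l'\<close>.\<close>
      define D where "D = C - {l, l'}"
      have "card D = card C - card {l, l'}"
        unfolding D_def using l C(2) by (intro card_Diff_subset) auto
      moreover have "card {l, l'} \<le> card C"
        using l C(2) by (intro card_mono) auto
      ultimately have "Suc (card D) = 2 * m"
        using C(3) False by auto
      moreover have "C - {l} = insert l' D" "C - {l'} = insert l D" "D \<subseteq> V" "finite D"
          "l \<in> V - D" "l' \<in> V - D"
        using l False C by (auto simp: D_def)
      ultimately show ?thesis
        using Suc.IH[THEN conjunct2, rule_format, of D l' l] by simp
    qed
    then have uu: "\<forall>l\<in>C. \<forall>l'\<in>C. Re (pairing_sum f (C - {l}) * cnj (pairing_sum f (C - {l'}))) \<ge> 0"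
      by blast
    show ?thesis
      using f C(1) jk by (intro conjI perturbed_sums[OF eta tau C(2) ne u uu] ballI) blast+
  qed
  have expand: "pairing_sum f (insert j C) = (\<Sum>l\<in>C. f {j, l} * pairing_sum f (C - {l}))"
    if "finite C" "j \<notin> C" for C j
  proof -
    have "insert j C - {j} = C" "insert j C - {j, l} = C - {l}" for l
      using that(2) by auto
    then show ?thesis
      using pairing_sum_expand[of "insert j C" j f] that(1) by simp
  qed
  have "pairing_sum f A \<noteq> 0" if A: "A \<subseteq> V" "finite A" "card A = 2 * Suc m" for A
  proof -
    obtain j C where "A = insert j C" "j \<notin> C" "card C = Suc (2 * m)"
      using A(3) card_Suc_eq[of A "Suc (2 * m)"] by auto
    then show ?thesis
      using A sub[of C j j] expand[of C j] by auto
  qed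
  moreover have "Re (pairing_sum f (insert j C) * cnj (pairing_sum f (insert k C))) \<ge> 0"
    if "C \<subseteq> V" "finite C" "Suc (card C) = 2 * Suc m" "j \<in> V - C" "k \<in> V - C" for C j k
    using sub[of C j k] expand[of C j] expand[of C k] that by auto
  ultimately show ?case
    by blast
qed

theorem theorem2p3:
  fixes \<eta> \<tau> :: real and n :: nat and Z :: "complex mat"
  assumes "0 \<le> \<eta>" and "\<eta> < 1"
    and "\<tau> = (1 - \<eta>) * sin (pi / 4 - arctan \<eta>)"
    and "n \<ge> 1"
    and "Z \<in> carrier_mat (2 * n) (2 * n)"
    and "transpose_mat Z = Z"
    and "\<And>i j. i < 2 * n \<Longrightarrow> j < 2 * n \<Longrightarrow> \<bar>1 - Re (Z $$ (i, j))\<bar> \<le> \<eta>"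
    and "\<And>i j. i < 2 * n \<Longrightarrow> j < 2 * n \<Longrightarrow> \<bar>Im (Z $$ (i, j))\<bar> \<le> \<tau>"
  shows "\<tau> > 0 \<and> hafnian Z \<noteq> 0"
proof
  have "arctan \<eta> < pi / 4"
    using assms(2) arctan_less_iff[of \<eta> 1] unfolding arctan_one by blast
  moreover have "arctan \<eta> \<ge> 0"
    using assms(1) by simp
  ultimately have "sin (pi / 4 - arctan \<eta>) > 0"
    using pi_gt_zero by (intro sin_gt_zero) linarith+
  then show "\<tau> > 0"
    using assms(2,3) by simp
  define f where "f P = Z $$ (Min P, Max P)" for P
  have f: "\<forall>i\<in>{..<2 * n}. \<forall>j\<in>{..<2 * n}. \<bar>1 - Re (f {i, j})\<bar> \<le> \<eta> \<and> \<bar>Im (f {i, j})\<bar> \<le> \<tau>"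
    unfolding f_def by (intro ballI conjI assms(7,8)) simp_all
  note pairing_sum_nonzero_non_obtuse[OF assms(1-3) f, of n]
  then have "pairing_sum f {..<2 * n} \<noteq> 0"
    by simp
  moreover have "hafnian Z = pairing_sum f {..<2 * n}"
    using assms(5) by (simp add: hafnian_def pairing_sum_def f_def)
  ultimately show "hafnian Z \<noteq> 0"
    by simp
qed

end
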